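(* For each $k\geq 1$ and $n\geq 2$ we have $$\dim_M(And(k)\,\square\, P_n)=\dim_M(\overline{And(k)}\,\square\, P_n)=k,$$ where $P_n$ is the path with $n$ vertices. In particular, the metric dimension of the prism generated by $And(k)$ or its complement $\overline{And(k)}$ is $k$.
   Context: All graphs are finite, simple and undirected. For a connected graph $G$, $d(x,y)$ denotes the length of a shortest path between vertices $x$ and $y$. A set $W\subseteq V(G)$ is a resolving set for $G$ if for each pair of distinct vertices $u,v\in V(G)$ there exists $t\in W$ with $d(u,t)\neq d(v,t)$. The metric dimension $\dim_M(G)$ is the minimum cardinality of a resolving set for $G$. $\overline{G}$ denotes the complement graph of $G$. The Cartesian product $G_1\square G_2$ has vertex set $V(G_1)\times V(G_2)$, with $(u,v)$ adjacent to $(u',v')$ whenever $u=u'$ and $vv'\in E(G_2)$, or $v=v'$ and $uu'\in E(G_1)$. The prism generated by $G$ is $G\square P_2$. For an integer $k\geq 1$, the Andrásfai graph $And(k)$ is the Cayley graph $Cay(\mathbb{Z}_{3k-1},S)$ of the additive group of integers modulo $3k-1$ with $S=\{1,4,7,\ldots,3k-2\}$ (the classes of the integers in $\{1,\ldots,3k-1\}$ congruent to $1$ modulo $3$; $S=-S$ and $0\notin S$). That is, its vertex set is $\mathbb{Z}_{3k-1}$ and two vertices $u,v$ are adjacent if and only if $u-v\in S$.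
   Formalization: The formal statement assumes k ≥ 2 instead of k ≥ 1, because at k = 1 the claim fails for every n ≥ 2: And(1) = K_2 gives a ladder of metric dimension 2, and the complement gives two disjoint paths, a disconnected graph. *)

theory Defs
  imports
    "Graph_Theory.Graph_Theory"
    "HOL-Algebra.Elementary_Groups"
begin

text \<open>
  A finite simple graph is a \<^locale>\<open>pair_graph\<close>: a finite vertex set together with a symmetric,
  irreflexive set of ordered pairs, an undirected edge being represented by its two orientations.
\<close>

text \<open>
  Shortest-path distance with unit weights, hence the minimal number of edges of a path (see
  \<open>graph_dist_eq_path\<close>); it is \<open>\<infinity>\<close> between different components.
\<close>

definition graph_dist :: "'a pair_pre_digraph \<Rightarrow> 'a \<Rightarrow> 'a \<Rightarrow> ereal" where
  "graph_dist G u v = wf_digraph.\<mu> (with_proj G) (\<lambda>_. 1) u v"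

lemma graph_dist_eq:
  assumes "pair_wf_digraph G"
  shows "graph_dist G u v = (INF p \<in> {p. pre_digraph.awalk (with_proj G) u p v}. ereal (real (length p)))"
proof -
  interpret pair_wf_digraph G by fact
  have *: "awalk_cost (\<lambda>_. 1) p = real (length p)" for p :: "('a \<times> 'a) list"
    by (induct p) (auto simp: awalk_cost_def)
  show ?thesis unfolding graph_dist_def \<mu>_def * ..
qed

lemma graph_dist_eq_path:
  assumes "pair_wf_digraph G"
  shows "graph_dist G u v = (INF p \<in> {p. pre_digraph.apath (with_proj G) u p v}. ereal (real (length p)))"
proof -
  interpret pair_wf_digraph G by fact
  have cost: "awalk_cost (\<lambda>_. 1) p = real (length p)" for p :: "('a \<times> 'a) list"
    by (induct p) (auto simp: awalk_cost_def)
  show ?thesis unfolding graph_dist_eq[OF assms]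
  proof (rule antisym)
    show "(INF p\<in>{p. awalk u p v}. ereal (real (length p))) \<le> (INF p\<in>{p. apath u p v}. ereal (real (length p)))"
      by (rule INF_superset_mono) (auto simp: apath_def)
  next
    show "(INF p\<in>{p. apath u p v}. ereal (real (length p))) \<le> (INF p\<in>{p. awalk u p v}. ereal (real (length p)))"
    proof (rule INF_greatest)
      fix p assume "p \<in> {p. awalk u p v}"
      then have p: "awalk u p v" by simp
      have no_neg: "\<not> (\<exists>w c. awalk w c w \<and> w \<in> set (pawalk_verts u p) \<and> awalk_cost (\<lambda>_. 1) c < 0)"
        by (simp add: cost)
      have "apath u (awalk_to_apath p) v" using p by (rule apath_awalk_to_apath)
      moreover have "length (awalk_to_apath p) \<le> length p"
        using awalk_to_path_no_neg_cyc_cost[OF p no_neg] by (simp add: cost)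
      ultimately show "(INF p\<in>{p. apath u p v}. ereal (real (length p))) \<le> ereal (real (length p))"
        by (intro INF_lower2[of "awalk_to_apath p"]) auto
    qed
  qed
qed

definition resolving_set :: "'a pair_pre_digraph \<Rightarrow> 'a set \<Rightarrow> bool" where
  "resolving_set G W \<longleftrightarrow> W \<subseteq> pverts G \<and>
    (\<forall>u \<in> pverts G. \<forall>v \<in> pverts G. u \<noteq> v \<longrightarrow> (\<exists>t \<in> W. graph_dist G u t \<noteq> graph_dist G v t))"

definition metric_dim :: "'a pair_pre_digraph \<Rightarrow> nat" where
  "metric_dim G = (LEAST m. \<exists>W. resolving_set G W \<and> card W = m)"

definition complement_graph :: "'a pair_pre_digraph \<Rightarrow> 'a pair_pre_digraph" where
  "complement_graph G = \<lparr>pverts = pverts G,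
     parcs = {(u, v). u \<in> pverts G \<and> v \<in> pverts G \<and> u \<noteq> v \<and> (u, v) \<notin> parcs G}\<rparr>"

definition cartesian_product ::
    "'a pair_pre_digraph \<Rightarrow> 'b pair_pre_digraph \<Rightarrow> ('a \<times> 'b) pair_pre_digraph"
    (infixr \<open>\<box>\<close> 70) where
  "G \<box> H = \<lparr>pverts = pverts G \<times> pverts H,
     parcs = {((u, v), (u', v')).
       u \<in> pverts G \<and> u = u' \<and> (v, v') \<in> parcs H \<or>
       v \<in> pverts H \<and> v = v' \<and> (u, u') \<in> parcs G}\<rparr>"

definition path_graph :: "nat \<Rightarrow> nat pair_pre_digraph" where
  "path_graph n = \<lparr>pverts = {..<n}, parcs = {(i, j). i < n \<and> j < n \<and> (j = Suc i \<or> i = Suc j)}\<rparr>"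

definition prism :: "'a pair_pre_digraph \<Rightarrow> ('a \<times> nat) pair_pre_digraph" where
  "prism G = G \<box> path_graph 2"

definition cayley_graph :: "('a, 'b) monoid_scheme \<Rightarrow> 'a set \<Rightarrow> 'a pair_pre_digraph" where
  "cayley_graph A S = \<lparr>pverts = carrier A,
     parcs = {(u, v). u \<in> carrier A \<and> v \<in> carrier A \<and> u \<otimes>\<^bsub>A\<^esub> inv\<^bsub>A\<^esub> v \<in> S}\<rparr>"

text \<open>
  The carrier of \<^term>\<open>integer_mod_group m\<close> is \<open>{0..<m}\<close>. As \<open>3 * k - 1\<close> is not congruent to 1
  modulo 3, every element of the connection set below is a canonical representative.
\<close>
definition andrasfai :: "nat \<Rightarrow> int pair_pre_digraph" where
  "andrasfai k = cayley_graph (integer_mod_group (3 * k - 1))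
     {s. 1 \<le> s \<and> s \<le> 3 * int k - 1 \<and> s mod 3 = 1}"

lemma pair_graphI:
  assumes "finite (pverts G)" "parcs G \<subseteq> pverts G \<times> pverts G" "sym (parcs G)" "irrefl (parcs G)"
  shows "pair_graph G"
proof -
  have "finite (parcs G)" using assms(1,2) finite_subset by blast
  then show ?thesis using assms
    by unfold_locales (auto simp: symmetric_def irrefl_def)
qed

lemma pair_graphD:
  assumes "pair_graph G"
  shows "finite (pverts G)" "parcs G \<subseteq> pverts G \<times> pverts G" "sym (parcs G)" "irrefl (parcs G)"
proof -
  interpret pair_graph G by fact
  show "finite (pverts G)" "parcs G \<subseteq> pverts G \<times> pverts G" "sym (parcs G)" "irrefl (parcs G)"
    using pair_finite_verts in_arcsD1 in_arcsD2 arcs_symmetric no_loops'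
    by (auto simp: sym_def irrefl_def) blast
qed

lemma pair_graph_complement_graph:
  "pair_graph G \<Longrightarrow> pair_graph (complement_graph G)"
  by (rule pair_graphI) (auto simp: complement_graph_def sym_def irrefl_def dest: pair_graphD)

lemma pair_graph_path_graph: "pair_graph (path_graph n)"
  by (rule pair_graphI) (auto simp: path_graph_def sym_def irrefl_def)

lemma pair_graph_cartesian_product:
  assumes "pair_graph G" "pair_graph H" shows "pair_graph (G \<box> H)"
  using pair_graphD[OF assms(1)] pair_graphD[OF assms(2)]
  by (intro pair_graphI) (auto simp: cartesian_product_def sym_def irrefl_def)

lemma andrasfai_sel:
  assumes "k \<ge> 1"
  shows "pverts (andrasfai k) = {0..<3 * int k - 1}"
    and "parcs (andrasfai k) = {(u, v). u \<in> {0..<3 * int k - 1} \<and> v \<in> {0..<3 * int k - 1} \<and>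
           (u - v) mod (3 * int k - 1) mod 3 = 1}"
proof -
  have m: "int (3 * k - 1) = 3 * int k - 1" "3 * k - 1 \<noteq> 0" using assms by auto
  have c: "carrier (integer_mod_group (3 * k - 1)) = {0..<3 * int k - 1}"
    unfolding carrier_integer_mod_group m(1) using m(2) by (rule if_not_P)
  show "pverts (andrasfai k) = {0..<3 * int k - 1}"
    unfolding andrasfai_def cayley_graph_def c by simp
  have eq: "u \<otimes>\<^bsub>integer_mod_group (3 * k - 1)\<^esub> inv\<^bsub>integer_mod_group (3 * k - 1)\<^esub> v
      = (u - v) mod (3 * int k - 1)" if "v \<in> {0..<3 * int k - 1}" for u v
  proof -
    have "inv\<^bsub>integer_mod_group (3 * k - 1)\<^esub> v = (- v) mod (3 * int k - 1)"
      using that c inv_integer_mod_group[of v "3 * k - 1"] unfolding m(1) by simp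
    then show ?thesis unfolding mult_integer_mod_group m(1) by (simp add: mod_simps)
  qed
  have rng: "1 \<le> x \<and> x \<le> 3 * int k - 1"
    if "x = y mod (3 * int k - 1)" "x mod 3 = 1" for x y :: int
  proof -
    have "0 \<le> x" "x < 3 * int k - 1" using that(1) assms by auto
    moreover have "x \<noteq> 0" using that(2) by auto
    ultimately show ?thesis by linarith
  qed
  show "parcs (andrasfai k) = {(u, v). u \<in> {0..<3 * int k - 1} \<and> v \<in> {0..<3 * int k - 1} \<and>
           (u - v) mod (3 * int k - 1) mod 3 = 1}"
    unfolding andrasfai_def cayley_graph_def c using eq rng by auto
qed

lemma pair_graph_andrasfai:
  assumes "k \<ge> 1" shows "pair_graph (andrasfai k)"
proof (rule pair_graphI)
  show "sym (parcs (andrasfai k))"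
  proof (rule symI)
    fix u v assume "(u, v) \<in> parcs (andrasfai k)"
    then have uv: "u \<in> {0..<3 * int k - 1}" "v \<in> {0..<3 * int k - 1}"
      "(u - v) mod (3 * int k - 1) mod 3 = 1"
      by (auto simp: andrasfai_sel[OF assms])
    let ?m = "3 * int k - 1" and ?x = "(u - v) mod (3 * int k - 1)"
    have "?x \<noteq> 0" using uv(3) by auto
    have "(v - u) mod ?m = (- (u - v)) mod ?m" by simp
    also have "\<dots> = ?m - ?x"
      using \<open>?x \<noteq> 0\<close> by (subst zmod_zminus1_eq_if) simp
    finally have "(v - u) mod ?m = ?m - ?x" .
    moreover have "(3 * int k - 1 - x) mod 3 = 1" if "x mod 3 = 1" for x
      using that by presburger
    ultimately have "(v - u) mod ?m mod 3 = 1" using uv(3) by simp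
    with uv show "(v, u) \<in> parcs (andrasfai k)" by (auto simp: andrasfai_sel[OF assms])
  qed
qed (auto simp: andrasfai_sel[OF assms] irrefl_def)

lemma graph_dist_refl:
  assumes "pair_graph G" "u \<in> pverts G" shows "graph_dist G u u = 0"
proof -
  interpret pair_graph G by fact
  have "awalk u [] u" using assms by (simp add: awalk_def)
  then have "graph_dist G u u \<le> ereal (real (length ([] :: ('a \<times> 'a) list)))"
    unfolding graph_dist_eq[OF pair_wf_digraph] by (intro INF_lower) simp
  moreover have "0 \<le> graph_dist G u u"
    unfolding graph_dist_eq[OF pair_wf_digraph] by (intro INF_greatest) simp
  ultimately show ?thesis by (simp add: zero_ereal_def)
qed

lemma graph_dist_ge_1:
  assumes "pair_graph G" "u \<noteq> v" shows "1 \<le> graph_dist G u v"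
proof -
  interpret pair_graph G by fact
  show ?thesis unfolding graph_dist_eq[OF pair_wf_digraph]
  proof (intro INF_greatest)
    fix p assume "p \<in> {p. awalk u p v}"
    then have "p \<noteq> []" using \<open>u \<noteq> v\<close> by (auto simp: awalk_def)
    then have "1 \<le> length p" by (cases p) auto
    then show "1 \<le> ereal (real (length p))" by (simp add: one_ereal_def)
  qed
qed

lemma graph_dist_adjacent:
  assumes "pair_graph G" "(u, v) \<in> parcs G" shows "graph_dist G u v = 1"
proof -
  interpret pair_graph G by fact
  have "awalk u [(u, v)] v" using assms in_arcsD1 by (auto simp: awalk_def)
  then have "graph_dist G u v \<le> ereal (real (length [(u, v)]))"
    unfolding graph_dist_eq[OF pair_wf_digraph] by (intro INF_lower) simp
  then show ?thesis
    using graph_dist_ge_1[OF assms(1) no_loops'[OF assms(2)]] by (simp add: one_ereal_def)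
qed

lemma resolving_set_pverts:
  assumes "pair_graph G" shows "resolving_set G (pverts G)"
  unfolding resolving_set_def
proof (intro conjI ballI impI)
  fix u v assume "u \<in> pverts G" "v \<in> pverts G" "u \<noteq> v"
  then have "graph_dist G u u = 0" "1 \<le> graph_dist G v u"
    using graph_dist_refl[OF assms] graph_dist_ge_1[OF assms] by auto
  then show "\<exists>t\<in>pverts G. graph_dist G u t \<noteq> graph_dist G v t"
    using \<open>u \<in> pverts G\<close> by (intro bexI[of _ u]) auto
qed simp

lemma metric_dim_witness:
  assumes "pair_graph G"
  obtains W where "resolving_set G W" "card W = metric_dim G"
proof -
  have "\<exists>W. resolving_set G W \<and> card W = metric_dim G"
    unfolding metric_dim_def
    by (rule LeastI_ex) (use resolving_set_pverts[OF assms] in blast)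
  with that show ?thesis by blast
qed

text \<open>
  At \<open>k = 1\<close> the graph is \<open>K\<^sub>2\<close>. Its product with \<open>P\<^sub>n\<close> is a ladder, and the product of the
  complement with \<open>P\<^sub>n\<close> is a disjoint union of two paths; for \<open>n \<ge> 2\<close> neither has metric
  dimension 1. A formula \<open>metric_dim = k\<close> for these products thus cannot include \<open>k = 1\<close>.
\<close>

lemma andrasfai_1:
  "pverts (andrasfai 1) = {0, 1}" "parcs (andrasfai 1) = {(0, 1), (1, 0)}"
proof -
  have *: "{0..<2} = {0, 1 :: int}" by auto
  show "pverts (andrasfai 1) = {0, 1}" using andrasfai_sel(1)[of 1] * by simp
  show "parcs (andrasfai 1) = {(0, 1), (1, 0)}"
    using andrasfai_sel(2)[of 1] * by auto
qed

lemma metric_dim_andrasfai_1: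
  assumes "n \<ge> 2"
  shows "metric_dim (andrasfai 1 \<box> path_graph n) \<noteq> 1"
proof
  let ?G = "andrasfai 1 \<box> path_graph n"
  have G: "pair_graph ?G"
    by (intro pair_graph_cartesian_product pair_graph_andrasfai pair_graph_path_graph) simp
  have pv: "pverts ?G = {0, 1} \<times> {..<n}"
    by (simp del: One_nat_def add: cartesian_product_def complement_graph_def path_graph_def andrasfai_1)
  assume "metric_dim ?G = 1"
  with metric_dim_witness[OF G] obtain W where W: "resolving_set ?G W" "card W = 1" by metis
  then obtain a i where Wai: "W = {(a, i)}" by (metis card_1_singletonE surj_pair)
  then have ai: "a \<in> {0, 1}" "i < n"
    using W(1) unfolding resolving_set_def Wai
    by (auto simp del: One_nat_def simp: pv)
  define j where "j = (if i = 0 then 1 else i - 1)"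
  have "((1 - a, i), (a, i)) \<in> parcs ?G" "((a, j), (a, i)) \<in> parcs ?G"
    using ai assms
    by (auto simp del: One_nat_def simp: cartesian_product_def path_graph_def andrasfai_1 j_def)
  note adj = this
  then have "graph_dist ?G (1 - a, i) (a, i) = graph_dist ?G (a, j) (a, i)"
    by (simp only: graph_dist_adjacent[OF G])
  moreover have "(1 - a, i) \<in> pverts ?G" "(a, j) \<in> pverts ?G"
    using adj pair_graphD(2)[OF G] by blast+
  moreover have "(1 - a, i) \<noteq> (a, j)" by (auto simp: j_def)
  ultimately show False using W(1) unfolding resolving_set_def Wai by (metis singletonD)
qed

lemma metric_dim_complement_andrasfai_1:
  assumes "n \<ge> 2"
  shows "metric_dim (complement_graph (andrasfai 1) \<box> path_graph n) \<noteq> 1"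
proof
  let ?G = "complement_graph (andrasfai 1) \<box> path_graph n"
  have G: "pair_graph ?G"
    by (intro pair_graph_cartesian_product pair_graph_andrasfai pair_graph_path_graph
        pair_graph_complement_graph) simp
  interpret pair_graph ?G by fact
  have pv: "pverts ?G = {0, 1} \<times> {..<n}"
    by (simp del: One_nat_def add: cartesian_product_def complement_graph_def path_graph_def andrasfai_1)
  assume "metric_dim ?G = 1"
  with metric_dim_witness[OF G] obtain W where W: "resolving_set ?G W" "card W = 1" by metis
  then obtain a i where Wai: "W = {(a, i)}" by (metis card_1_singletonE surj_pair)
  then have ai: "a \<in> {0, 1}"
    using W(1) unfolding resolving_set_def Wai
    by (auto simp del: One_nat_def simp: pv)
  have fst_walk: "fst x = fst y" if "awalk x p y" for x y p
    using that
  proof (induct p arbitrary: x)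
    case Nil
    then show ?case by (simp del: One_nat_def add: awalk_def)
  next
    case (Cons e p)
    then have "e \<in> parcs ?G" "x = fst e" "fst (snd e) = fst y"
      by (auto simp del: One_nat_def simp: awalk_Cons_iff)
    then show ?case
      by (auto simp del: One_nat_def simp: cartesian_product_def complement_graph_def andrasfai_1)
  qed
  have inf: "graph_dist ?G (1 - a, j) (a, i) = \<infinity>" for j
  proof -
    have "{p. awalk (1 - a, j) p (a, i)} = {}" using fst_walk ai by fastforce
    then show ?thesis unfolding graph_dist_eq[OF pair_wf_digraph] by (simp add: top_ereal_def)
  qed
  have "(1 - a, 0) \<in> pverts ?G" "(1 - a, 1) \<in> pverts ?G"
    using ai assms unfolding pv by auto
  moreover have "(1 - a, 0) \<noteq> (1 - a, 1 :: nat)" by simp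
  ultimately show False using W(1) inf unfolding resolving_set_def Wai by (metis singletonD)
qed

end

theory Submission
  imports Defs
begin

text \<open>
  Both \<open>And(k)\<close> and its complement have diameter at most 2 when \<open>k \<ge> 2\<close>, and distances in a
  Cartesian product are sums of distances in the factors. In \<open>G \<box> P\<^sub>n\<close> the distance from \<open>(u, i)\<close> to
  \<open>(t, a)\<close> is thus the distance from \<open>u\<close> to \<open>t\<close>, one of 0, 1, 2 according to equality and
  adjacency, plus \<open>\<bar>i - a\<bar>\<close>.

  Lower bound. Two vertices on one level are only distinguished through the first factor, so the
  projection \<open>W\<close> of a resolving set to \<open>\<int>\<close> modulo \<open>m = 3 k - 1\<close> must separate any two vertices
  by equality or adjacency, a condition that is the same for \<open>And(k)\<close> and for its complement.
  The two vertices \<open>x\<close> and \<open>x + 3 d\<close>, where \<open>1 \<le> d < k\<close>, are separated only by elements of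
  the cyclic interval from \<open>x\<close> to \<open>x + 3 d\<close> other than \<open>x + 3, \<dots>, x + 3 (d - 1)\<close>. For \<open>d = 1\<close>
  this says that cyclically consecutive elements of \<open>W\<close> differ by at most 4; for larger \<open>d\<close> it
  says that two gaps of length 4 are never joined by a run of gaps of length 3 (possibly empty).
  Hence between two gaps of length 4 there is one of length at most 2, the average gap does not
  exceed 3 unless only one gap has length 4, and in all cases \<open>m \<le> 3 \<bar>W\<bar> + 1\<close>. As \<open>m = 3 k - 1\<close>,
  this gives \<open>k \<le> \<bar>W\<bar>\<close>. The counting is \<open>card_blocks_after_gap\<close> and \<open>card_ge_of_windows\<close>,
  the graph theory is \<open>card_ge_of_separating\<close>.

  Upper bound. A set placed on the bottom level of \<open>G \<box> P\<^sub>n\<close> is resolving if the vectors of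
  distances in \<open>G\<close> of any two distinct vertices do not differ by a constant
  (\<open>resolving_set_bottom_layer\<close>). For \<open>And(k)\<close> the set \<open>{0, 3, \<dots>, 3 k - 3}\<close> has this property,
  for the complement \<open>{0} \<union> {1, 4, \<dots>, 3 k - 5}\<close> does.
\<close>

section \<open>Distances from layerings\<close>

text \<open>
  A function with these three local properties can only be the distance to \<open>t\<close>: it decreases by at
  most one along an arc, and it can always be decreased by one. This makes distances checkable
  arc by arc, without reference to walks.
\<close>

definition layering :: "'a pair_pre_digraph \<Rightarrow> 'a \<Rightarrow> ('a \<Rightarrow> nat) \<Rightarrow> bool" where
  "layering G t D \<longleftrightarrow> D t = 0
    \<and> (\<forall>(u, v) \<in> parcs G. D u \<le> Suc (D v))
    \<and> (\<forall>u \<in> pverts G. u \<noteq> t \<longrightarrow> (\<exists>v. (u, v) \<in> parcs G \<and> D u = Suc (D v)))"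

lemma graph_dist_layering:
  assumes G: "pair_graph G" and D: "layering G t D" and t: "t \<in> pverts G" and u: "u \<in> pverts G"
  shows "graph_dist G u t = ereal (real (D u))"
proof -
  interpret pair_graph G by fact
  have lower: "D x \<le> length p" if "awalk x p t" for x p
    using that
  proof (induct p arbitrary: x)
    case Nil
    then show ?case using D by (simp add: awalk_def layering_def)
  next
    case (Cons e p)
    then have "e \<in> parcs G" "x = fst e" "awalk (snd e) p t"
      by (auto simp: awalk_Cons_iff)
    moreover from this have "D (fst e) \<le> Suc (D (snd e))"
      using D by (auto simp: layering_def case_prod_beta)
    ultimately show ?case using Cons(1)[of "snd e"] by simp
  qed
  have descend: "\<exists>p. awalk x p t \<and> length p = D x" if "x \<in> pverts G" for x
    using that
  proof (induct "D x" arbitrary: x rule: less_induct)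
    case less
    show ?case
    proof (cases "x = t")
      case True
      then show ?thesis using t D by (intro exI[of _ "[]"]) (simp add: awalk_def layering_def)
    next
      case False
      then obtain v where v: "(x, v) \<in> parcs G" "D x = Suc (D v)"
        using D less(2) by (auto simp: layering_def)
      then have "v \<in> pverts G" using in_arcsD2 by blast
      then obtain p where "awalk v p t" "length p = D v"
        using less(1)[of v] v(2) by auto
      then show ?thesis using v less(2)
        by (intro exI[of _ "(x, v) # p"]) (simp add: awalk_Cons_iff)
    qed
  qed
  obtain p where p: "awalk u p t" "length p = D u" using descend[OF u] by blast
  show ?thesis unfolding graph_dist_eq[OF pair_wf_digraph]
  proof (rule antisym)
    show "(INF p\<in>{p. awalk u p t}. ereal (real (length p))) \<le> ereal (real (D u))"
      using p by (intro INF_lower2[of p]) auto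
    show "ereal (real (D u)) \<le> (INF p\<in>{p. awalk u p t}. ereal (real (length p)))"
      using lower by (intro INF_greatest) auto
  qed
qed

lemma layering_cartesian_product:
  assumes "layering G s D" "layering H t E"
    and G: "pair_graph G" and H: "pair_graph H"
  shows "layering (G \<box> H) (s, t) (\<lambda>(u, v). D u + E v)"
  unfolding layering_def
proof (intro conjI ballI impI)
  show "(case (s, t) of (u, v) \<Rightarrow> D u + E v) = 0" using assms by (simp add: layering_def)
  fix e assume "e \<in> parcs (G \<box> H)"
  then show "case e of (x, y) \<Rightarrow> (case x of (u, v) \<Rightarrow> D u + E v) \<le> Suc (case y of (u, v) \<Rightarrow> D u + E v)"
    using assms(1,2) by (fastforce simp: cartesian_product_def layering_def)
next
  fix x assume x: "x \<in> pverts (G \<box> H)" "x \<noteq> (s, t)"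
  obtain u v where uv: "x = (u, v)" "u \<in> pverts G" "v \<in> pverts H"
    using x by (auto simp: cartesian_product_def)
  show "\<exists>y. (x, y) \<in> parcs (G \<box> H) \<and> (case x of (u, v) \<Rightarrow> D u + E v) = Suc (case y of (u, v) \<Rightarrow> D u + E v)"
  proof (cases "u = s")
    case True
    then obtain v' where "(v, v') \<in> parcs H" "E v = Suc (E v')"
      using assms(2) uv x by (auto simp: layering_def)
    then show ?thesis using uv by (intro exI[of _ "(u, v')"]) (auto simp: cartesian_product_def)
  next
    case False
    then obtain u' where "(u, u') \<in> parcs G" "D u = Suc (D u')"
      using assms(1) uv by (auto simp: layering_def)
    then show ?thesis using uv by (intro exI[of _ "(u', v)"]) (auto simp: cartesian_product_def)
  qed
qed

lemma layering_path_graph: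
  assumes "a < n"
  shows "layering (path_graph n) a (\<lambda>i. nat \<bar>int i - int a\<bar>)"
  unfolding layering_def
proof (intro conjI ballI impI)
  fix i assume i: "i \<in> pverts (path_graph n)" "i \<noteq> a"
  define j where "j = (if i < a then Suc i else i - 1)"
  show "\<exists>j. (i, j) \<in> parcs (path_graph n) \<and> nat \<bar>int i - int a\<bar> = Suc (nat \<bar>int j - int a\<bar>)"
    by (rule exI[of _ j]) (use i assms in \<open>auto simp: path_graph_def j_def\<close>)
qed (auto simp: path_graph_def)

text \<open>
  The distance in a graph of diameter at most 2; see \<open>layering_dist2\<close>.
\<close>

definition dist2 :: "'a pair_pre_digraph \<Rightarrow> 'a \<Rightarrow> 'a \<Rightarrow> nat" where
  "dist2 G u t = (if u = t then 0 else if (u, t) \<in> parcs G then 1 else 2)"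

definition diameter_le_2 :: "'a pair_pre_digraph \<Rightarrow> bool" where
  "diameter_le_2 G \<longleftrightarrow> (\<forall>u \<in> pverts G. \<forall>t \<in> pverts G. u \<noteq> t \<longrightarrow> (u, t) \<notin> parcs G \<longrightarrow>
     (\<exists>w. (u, w) \<in> parcs G \<and> (w, t) \<in> parcs G))"

lemma layering_dist2:
  assumes G: "pair_graph G" and "diameter_le_2 G" and t: "t \<in> pverts G"
  shows "layering G t (\<lambda>u. dist2 G u t)"
proof -
  have arc: "u \<noteq> v" if "(u, v) \<in> parcs G" for u v
    using pair_graphD(4)[OF G] that by (auto simp: irrefl_def)
  have sym: "(v, u) \<in> parcs G" if "(u, v) \<in> parcs G" for u v
    using pair_graphD(3)[OF G] that by (auto simp: sym_def)
  show ?thesis unfolding layering_def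
  proof (intro conjI ballI impI)
    fix e assume "e \<in> parcs G"
    then show "case e of (u, v) \<Rightarrow> dist2 G u t \<le> Suc (dist2 G v t)"
      by (auto simp: dist2_def)
  next
    fix u assume u: "u \<in> pverts G" "u \<noteq> t"
    show "\<exists>v. (u, v) \<in> parcs G \<and> dist2 G u t = Suc (dist2 G v t)"
    proof (cases "(u, t) \<in> parcs G")
      case True
      then show ?thesis using u by (intro exI[of _ t]) (simp add: dist2_def)
    next
      case False
      then obtain w where "(u, w) \<in> parcs G" "(w, t) \<in> parcs G"
        using assms(2) u t by (auto simp: diameter_le_2_def)
      then show ?thesis using u False arc by (intro exI[of _ w]) (auto simp: dist2_def)
    qed
  qed (simp add: dist2_def)
qed

lemma graph_dist_product_path:
  assumes G: "pair_graph G" "diameter_le_2 G"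
    and "u \<in> pverts G" "t \<in> pverts G" "i < n" "a < n"
  shows "graph_dist (G \<box> path_graph n) (u, i) (t, a) = ereal (real (dist2 G u t + nat \<bar>int i - int a\<bar>))"
  using graph_dist_layering[OF pair_graph_cartesian_product[OF G(1) pair_graph_path_graph]
      layering_cartesian_product[OF layering_dist2[OF G assms(4)] layering_path_graph[OF assms(6)]
        G(1) pair_graph_path_graph], of "(u, i)"] assms
  by (auto simp: cartesian_product_def path_graph_def)

section \<open>Resolving sets\<close>

text \<open>
  On a common level the contribution of the path factor cancels, so the first coordinates of a
  resolving set resolve \<open>G\<close>.
\<close>

lemma resolving_set_projection:
  assumes G: "pair_graph G" "diameter_le_2 G" and n: "n \<ge> 1"
    and W: "resolving_set (G \<box> path_graph n) W"
    and uv: "u \<in> pverts G" "v \<in> pverts G" "u \<noteq> v"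
  shows "\<exists>t \<in> fst ` W. dist2 G u t \<noteq> dist2 G v t"
proof -
  have sub: "W \<subseteq> pverts G \<times> {..<n}"
    using W by (auto simp: resolving_set_def cartesian_product_def path_graph_def)
  have "(u, 0) \<in> pverts (G \<box> path_graph n)" "(v, 0) \<in> pverts (G \<box> path_graph n)" "(u, 0::nat) \<noteq> (v, 0)"
    using uv n by (auto simp: cartesian_product_def path_graph_def)
  then obtain t a where ta: "(t, a) \<in> W"
    "graph_dist (G \<box> path_graph n) (u, 0) (t, a) \<noteq> graph_dist (G \<box> path_graph n) (v, 0) (t, a)"
    using W unfolding resolving_set_def by (metis surj_pair)
  have ta': "t \<in> pverts G" "a < n" "0 < n" using ta(1) sub n by auto
  have "dist2 G u t \<noteq> dist2 G v t"
    using ta(2) by (auto simp: graph_dist_product_path[OF G uv(1) ta'(1,3,2)]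
        graph_dist_product_path[OF G uv(2) ta'(1,3,2)])
  then show ?thesis using ta(1) by force
qed

text \<open>
  For \<open>t\<close> on level 0 the vertex \<open>(u, i)\<close> has distance \<open>dist2 G u t + i\<close>. The level is a shift common
  to all \<open>t\<close>, hence it is enough that no two vectors of distances in \<open>G\<close> differ by a constant.
\<close>

lemma resolving_set_bottom_layer:
  assumes G: "pair_graph G" "diameter_le_2 G" and n: "n \<ge> 1" and W: "W \<subseteq> pverts G"
    and res: "\<And>u v i j. u \<in> pverts G \<Longrightarrow> v \<in> pverts G \<Longrightarrow>
      (\<And>t. t \<in> W \<Longrightarrow> dist2 G u t + i = dist2 G v t + j) \<Longrightarrow> u = v \<and> i = j"
  shows "resolving_set (G \<box> path_graph n) (W \<times> {0})"
  unfolding resolving_set_def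
proof (intro conjI ballI impI)
  show "W \<times> {0} \<subseteq> pverts (G \<box> path_graph n)"
    using W n by (auto simp: cartesian_product_def path_graph_def)
  fix x y assume xy: "x \<in> pverts (G \<box> path_graph n)" "y \<in> pverts (G \<box> path_graph n)" "x \<noteq> y"
  obtain u i v j where *: "x = (u, i)" "y = (v, j)" "u \<in> pverts G" "v \<in> pverts G" "i < n" "j < n"
    using xy by (auto simp: cartesian_product_def path_graph_def)
  then obtain t where t: "t \<in> W" "dist2 G u t + i \<noteq> dist2 G v t + j"
    using res[of u v i j] xy(3) by blast
  have t': "t \<in> pverts G" "0 < n" using t(1) W n by auto
  show "\<exists>t\<in>W \<times> {0}. graph_dist (G \<box> path_graph n) x t \<noteq> graph_dist (G \<box> path_graph n) y t"
    using t(2) by (intro bexI[of _ "(t, 0)"])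
      (simp_all add: * t(1) graph_dist_product_path[OF G *(3) t'(1) *(5) t'(2)]
        graph_dist_product_path[OF G *(4) t'(1) *(6) t'(2)] del: of_nat_add)
qed

lemma metric_dim_eqI:
  assumes "pair_graph G" "resolving_set G W" "card W = k"
    and "\<And>W'. resolving_set G W' \<Longrightarrow> k \<le> card W'"
  shows "metric_dim G = k"
proof (rule antisym)
  show "metric_dim G \<le> k" unfolding metric_dim_def by (rule Least_le) (use assms in blast)
  show "k \<le> metric_dim G" using metric_dim_witness[OF assms(1)] assms(4) by metis
qed

section \<open>A counting lemma\<close>

lemma card_block_step:
  fixes A :: "int set" and b :: int
  shows "card (A \<inter> {b..b + 3 * int (Suc j)}) =
    card (A \<inter> {b..b + 3 * int j}) + card (A \<inter> {b + 3 * int j + 1..b + 3 * int j + 3})"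
proof -
  have "A \<inter> {b..b + 3 * int (Suc j)} =
    (A \<inter> {b..b + 3 * int j}) \<union> (A \<inter> {b + 3 * int j + 1..b + 3 * int j + 3})" by auto
  then show ?thesis by (simp add: card_Un_disjoint disjoint_iff)
qed

text \<open>
  The positions that can separate \<open>x\<close> from \<open>x + 3 d\<close> in an Andrasfai graph: strictly between the
  two, multiples of 3 away from \<open>x\<close> are adjacent to neither.
\<close>

definition meets_window :: "int set \<Rightarrow> int \<Rightarrow> int \<Rightarrow> bool" where
  "meets_window A x d \<longleftrightarrow> (\<exists>t \<in> A. x \<le> t \<and> t \<le> x + 3 * d \<and> (\<forall>e. 0 < e \<and> e < d \<longrightarrow> t \<noteq> x + 3 * e))"

text \<open>
  The reason is an invariant kept while moving right one block of three positions at a time: either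
  there is one element to spare, beyond the \<open>j + 1\<close> required, or the count is tight but
  some window from \<open>b + 3 j - 3 d\<close> to \<open>b + 3 j + 3\<close> is not met by the elements up to \<open>b + 3 j\<close>
  (the predicate \<open>T\<close>). In the first case an empty block uses up the spare element and leaves the
  window with \<open>d = 0\<close> after it pending. In the second case the pending window has to be met in the
  new block. If the last position of the block is not in \<open>A\<close>, then \<open>d = 0\<close> works again; if it is
  the only element of the block, then \<open>d + 1\<close> works, because that position is a multiple of 3 away
  from the start of the window; otherwise there are two elements and one of them is spare.
\<close>

lemma card_blocks_after_gap:
  fixes A :: "int set"
  assumes win: "\<And>x d. 1 \<le> d \<Longrightarrow> d \<le> int K \<Longrightarrow> meets_window A x d"
    and gap: "b - 3 \<notin> A" "b - 2 \<notin> A" "b - 1 \<notin> A" and j: "j + 1 \<le> K"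
  shows "j + 1 \<le> card (A \<inter> {b..b + 3 * int j})"
proof -
  define N where "N j = card (A \<inter> {b..b + 3 * int j})" for j
  define B where "B j = A \<inter> {b + 3 * int j + 1..b + 3 * int j + 3}" for j
  define T where "T j \<longleftrightarrow> (\<exists>d \<ge> 0. d \<le> int j + 1 \<and>
    (\<forall>t \<in> A. b + 3 * int j - 3 * d \<le> t \<and> t \<le> b + 3 * int j \<longrightarrow> (\<exists>e. 0 \<le> e \<and> e < d \<and> t = b + 3 * int j - 3 * e)))" for j
  have N_Suc: "N (Suc j) = N j + card (B j)" for j
    unfolding N_def B_def by (rule card_block_step)
  have fin: "finite (B j)" for j by (simp add: B_def)
  have T0: "T (Suc j)" if "b + 3 * int j + 3 \<notin> A" for j
    unfolding T_def by (rule exI[of _ 0]) (use that in \<open>auto simp: algebra_simps\<close>)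
  \<comment> \<open>The free positions before \<open>b\<close> allow the pending window to begin as early as \<open>b - 3\<close>, hence
    \<open>d \<le> j + 1\<close> in \<open>T\<close>.\<close>
  have "N j \<ge> j + 1 \<and> (N j \<ge> j + 2 \<or> T j)" if "j + 1 \<le> K" for j
    using that
  proof (induct j)
    case 0
    then have "meets_window A (b - 3) 1" using win by simp
    then obtain t where t: "t \<in> A" "b - 3 \<le> t" "t \<le> b" by (auto simp: meets_window_def)
    have "t \<noteq> b - 3" "t \<noteq> b - 2" "t \<noteq> b - 1" using t(1) gap by auto
    then have "t = b" using t by linarith
    then have "b \<in> A" using t by simp
    then have "N 0 = 1" by (simp add: N_def)
    moreover have "T 0" unfolding T_def
    proof (rule exI[of _ 1], intro conjI ballI impI)
      fix t assume "t \<in> A" "b + 3 * int 0 - 3 * 1 \<le> t \<and> t \<le> b + 3 * int 0"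
      moreover from this have "t \<noteq> b - 3" "t \<noteq> b - 2" "t \<noteq> b - 1" using gap by auto
      ultimately show "\<exists>e. 0 \<le> e \<and> e < 1 \<and> t = b + 3 * int 0 - 3 * e" by (intro exI[of _ 0]) simp
    qed auto
    ultimately show ?case by simp
  next
    case (Suc j)
    show ?case
    proof (cases "N j \<ge> j + 2")
      case True
      show ?thesis
      proof (cases "B j = {}")
        case True
        then have "b + 3 * int j + 3 \<notin> A" by (auto simp: B_def)
        then show ?thesis using T0[of j] N_Suc[of j] \<open>N j \<ge> j + 2\<close> by simp
      next
        case False
        then have "card (B j) \<ge> 1" using fin[of j] by (simp add: Suc_leI card_gt_0_iff)
        then show ?thesis using N_Suc[of j] True by simp
      qed
    next
      case False
      then have Nj: "N j \<ge> j + 1" and "T j" using Suc by auto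
      then obtain d where d: "d \<ge> 0" "d \<le> int j + 1"
        "\<And>t. t \<in> A \<Longrightarrow> b + 3 * int j - 3 * d \<le> t \<Longrightarrow> t \<le> b + 3 * int j \<Longrightarrow> \<exists>e. 0 \<le> e \<and> e < d \<and> t = b + 3 * int j - 3 * e"
        unfolding T_def by blast
      have "meets_window A (b + 3 * int j - 3 * d) (d + 1)" using win[of "d + 1"] d Suc(2) by simp
      then obtain t where t: "t \<in> A" "b + 3 * int j - 3 * d \<le> t" "t \<le> b + 3 * int j + 3"
        "\<And>e. 0 < e \<Longrightarrow> e < d + 1 \<Longrightarrow> t \<noteq> b + 3 * int j - 3 * d + 3 * e"
        by (auto simp: meets_window_def algebra_simps)
      have "\<not> t \<le> b + 3 * int j"
      proof
        assume "t \<le> b + 3 * int j"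
        then obtain e where "0 \<le> e" "e < d" "t = b + 3 * int j - 3 * e" using d(3) t by blast
        then show False using t(4)[of "d - e"] by simp
      qed
      then have tB: "t \<in> B j" using t by (simp add: B_def)
      then have B1: "card (B j) \<ge> 1" using fin[of j] by (auto simp: Suc_le_eq card_gt_0_iff)
      have "N (Suc j) \<ge> Suc j + 2 \<or> T (Suc j)"
      proof (cases "B j = {b + 3 * int j + 3}")
        case True
        have "T (Suc j)" unfolding T_def
        proof (rule exI[of _ "d + 1"], intro conjI ballI impI)
          fix s assume s: "s \<in> A" "b + 3 * int (Suc j) - 3 * (d + 1) \<le> s \<and> s \<le> b + 3 * int (Suc j)"
          show "\<exists>e. 0 \<le> e \<and> e < d + 1 \<and> s = b + 3 * int (Suc j) - 3 * e"
          proof (cases "s \<le> b + 3 * int j")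
            case True
            moreover have "b + 3 * int j - 3 * d \<le> s" using s(2) by simp
            ultimately obtain e where "0 \<le> e" "e < d" "s = b + 3 * int j - 3 * e"
              using d(3)[OF s(1)] by blast
            then show ?thesis by (intro exI[of _ "e + 1"]) simp
          next
            case False
            then have "s \<in> B j" using s by (simp add: B_def)
            then show ?thesis using \<open>B j = {b + 3 * int j + 3}\<close> d by (intro exI[of _ 0]) simp
          qed
        qed (use d in auto)
        then show ?thesis ..
      next
        case False
        show ?thesis
        proof (cases "b + 3 * int j + 3 \<in> A")
          case True
          then have "b + 3 * int j + 3 \<in> B j" by (simp add: B_def)
          then have "{b + 3 * int j + 3} \<subset> B j" using False by blast
          then have "card {b + 3 * int j + 3} < card (B j)" by (rule psubset_card_mono[OF fin])
          then show ?thesis using N_Suc[of j] Nj by simp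
        next
          case False
          then show ?thesis using T0 by blast
        qed
      qed
      then show ?thesis using N_Suc[of j] Nj B1 by simp
    qed
  qed
  then show ?thesis using j by (simp add: N_def)
qed

text \<open>
  If every three consecutive positions meet \<open>A\<close>, start at an element \<open>b\<close>: the \<open>k - 1\<close> blocks of
  three after it give \<open>k - 1\<close> more elements, and all of them lie within one period. Otherwise start
  just after three free positions. The preceding lemma reaches the block number \<open>k - 2\<close>, where the
  windows available end; the last block needs a separate argument.
\<close>

lemma card_ge_of_windows:
  fixes W :: "int set" and k :: nat
  assumes k: "k \<ge> 2" and fin: "finite W"
    and win: "\<And>x d. 1 \<le> d \<Longrightarrow> d \<le> int k - 1 \<Longrightarrow> meets_window {x. x mod (3 * int k - 1) \<in> W} x d"
  shows "k \<le> card W"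
proof -
  define m where "m = 3 * int k - 1"
  define A where "A = {x. x mod m \<in> W}"
  have win': "meets_window A x d" if "1 \<le> d" "d \<le> int (k - 1)" for x d
    using win[of d x] that k by (simp add: A_def m_def of_nat_diff)
  obtain b where "k \<le> card (A \<inter> {b..b + 3 * int (k - 1)})"
  proof (cases "\<exists>b. b - 3 \<notin> A \<and> b - 2 \<notin> A \<and> b - 1 \<notin> A")
    case True
    then obtain b where b: "b - 3 \<notin> A" "b - 2 \<notin> A" "b - 1 \<notin> A" by blast
    have per: "x + m \<in> A \<longleftrightarrow> x \<in> A" for x by (simp add: A_def)
    have notin: "b - 3 + m \<notin> A" "b - 2 + m \<notin> A" "b - 1 + m \<notin> A" using b per by auto
    obtain j where j: "k = Suc (Suc j)" using k by (metis add_2_eq_Suc le_Suc_ex)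
    \<comment> \<open>By periodicity the three free positions before \<open>b\<close> recur at \<open>b - 3 + m, \<dots>, b - 1 + m\<close>. The
      position \<open>b - 4 + m = b + 3 k - 5\<close> preceding them begins the last block, and it must be in \<open>A\<close>
      because gaps are at most 4.\<close>
    have "meets_window A (b - 4 + m) 1" using win' k by simp
    then obtain t where t: "t \<in> A" "b - 4 + m \<le> t" "t \<le> b - 1 + m"
      by (auto simp: meets_window_def)
    then have "t \<noteq> b - 3 + m" "t \<noteq> b - 2 + m" "t \<noteq> b - 1 + m" using notin by auto
    then have "t = b - 4 + m" using t by linarith
    then have "t \<in> A \<inter> {b + 3 * int j + 1..b + 3 * int j + 3}" using t by (simp add: m_def j)
    then have "1 \<le> card (A \<inter> {b + 3 * int j + 1..b + 3 * int j + 3})"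
      by (metis One_nat_def Suc_leI card_gt_0_iff empty_iff finite_Int finite_atLeastAtMost_int)
    moreover have "j + 1 \<le> card (A \<inter> {b..b + 3 * int j})"
      by (rule card_blocks_after_gap[where K = "k - 1"]) (use win' b j in auto)
    ultimately have "k \<le> card (A \<inter> {b..b + 3 * int (Suc j)})"
      unfolding card_block_step by (simp add: j)
    then show ?thesis using that[of b] by (simp add: j)
  next
    case False
    then have hit: "b - 3 \<in> A \<or> b - 2 \<in> A \<or> b - 1 \<in> A" for b by blast
    then obtain b where b: "b \<in> A" by blast
    have "j + 1 \<le> card (A \<inter> {b..b + 3 * int j})" for j
    proof (induct j)
      case 0
      then show ?case using b by simp
    next
      case (Suc j)
      have "A \<inter> {b + 3 * int j + 1..b + 3 * int j + 3} \<noteq> {}"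
        using hit[of "b + 3 * int j + 4"] by auto
      then have "1 \<le> card (A \<inter> {b + 3 * int j + 1..b + 3 * int j + 3})"
        by (simp add: Suc_leI card_gt_0_iff)
      then show ?case using Suc unfolding card_block_step by simp
    qed
    from this[of "k - 1"] show ?thesis using that[of b] k by simp
  qed
  also have "\<dots> \<le> card W"
  proof (rule card_inj_on_le)
    show "inj_on (\<lambda>x. x mod m) (A \<inter> {b..b + 3 * int (k - 1)})"
    proof (rule inj_onI)
      fix x y assume xy: "x \<in> A \<inter> {b..b + 3 * int (k - 1)}" "y \<in> A \<inter> {b..b + 3 * int (k - 1)}" "x mod m = y mod m"
      then have "m dvd x - y" by (simp add: mod_eq_dvd_iff)
      moreover have "\<bar>x - y\<bar> < m" using xy k by (auto simp: m_def of_nat_diff)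
      ultimately show "x = y" using zdvd_imp_le[of m "\<bar>x - y\<bar>"] by auto
    qed
  qed (auto simp: A_def fin)
  finally show ?thesis .
qed

section \<open>Distances in Andrasfai graphs and their complements\<close>

text \<open>
  Modulo \<open>3 k - 1\<close>, a difference \<open>x\<close> has residue class \<open>1\<close> modulo 3 exactly if \<open>- x\<close> has: both
  representatives add up to \<open>3 k - 1\<close>, which is 2 modulo 3. For canonical representatives adjacency
  therefore depends only on \<open>\<bar>u - v\<bar>\<close> modulo 3.
\<close>

lemma parcs_andrasfai_iff:
  assumes k: "k \<ge> 1" and "u \<in> {0..<3 * int k - 1}" "v \<in> {0..<3 * int k - 1}"
  shows "(u, v) \<in> parcs (andrasfai k) \<longleftrightarrow> (if v \<le> u then (u - v) mod 3 = 1 else (v - u) mod 3 = 1)"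
proof (cases "v \<le> u")
  case True
  then have "(u - v) mod (3 * int k - 1) = u - v" using assms by (intro mod_pos_pos_trivial) auto
  then show ?thesis using assms True by (simp add: andrasfai_sel)
next
  case False
  have "(u - v) mod (3 * int k - 1) = (u - v + (3 * int k - 1)) mod (3 * int k - 1)" by simp
  also have "\<dots> = u - v + (3 * int k - 1)" using assms False by (intro mod_pos_pos_trivial) auto
  finally have *: "(u - v) mod (3 * int k - 1) = u - v + (3 * int k - 1)" .
  have "(u - v + (3 * int k - 1)) mod 3 = 1 \<longleftrightarrow> (v - u) mod 3 = 1" by presburger
  then show ?thesis using assms False by (simp add: andrasfai_sel *)
qed

text \<open>
  The same criterion for arbitrary integers within one period, which allows cyclic intervals to be
  treated as intervals of integers.
\<close>

lemma parcs_andrasfai_mod_iff: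
  assumes k: "k \<ge> 1" and xt: "x \<le> t" "t < x + (3 * int k - 1)"
  shows "(x mod (3 * int k - 1), t mod (3 * int k - 1)) \<in> parcs (andrasfai k) \<longleftrightarrow> (t - x) mod 3 = 1"
proof -
  define m where "m = 3 * int k - 1"
  have m: "m > 0" using k by (simp add: m_def)
  have rng: "x mod m \<in> {0..<3 * int k - 1}" "t mod m \<in> {0..<3 * int k - 1}"
    using m by (simp_all add: m_def)
  have sym: "(x mod m, t mod m) \<in> parcs (andrasfai k) \<longleftrightarrow> (t mod m, x mod m) \<in> parcs (andrasfai k)"
    using pair_graphD(3)[OF pair_graph_andrasfai[OF k]] by (auto simp: sym_def)
  have "(t mod m - x mod m) mod m = t - x"
    using xt by (simp add: mod_simps m_def)
  then have "(t mod m, x mod m) \<in> parcs (andrasfai k) \<longleftrightarrow> (t - x) mod 3 = 1"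
    using rng m by (simp add: andrasfai_sel[OF k] flip: m_def)
  then show ?thesis using sym by (simp add: m_def)
qed

text \<open>
  If \<open>t\<close> lies a multiple of 3 after \<open>u\<close>, then \<open>u - 1\<close> is adjacent to both. Two distinct nonadjacent
  vertices are always so related in one of the two orders, since the differences \<open>t - u\<close> and
  \<open>u - t\<close> modulo \<open>3 k - 1\<close> add up to \<open>3 k - 1\<close>.
\<close>

lemma diameter_andrasfai:
  assumes k: "k \<ge> 1" shows "diameter_le_2 (andrasfai k)"
  unfolding diameter_le_2_def
proof (intro ballI impI)
  define m where "m = 3 * int k - 1"
  have m: "m > 0" using k by (simp add: m_def)
  note iff = parcs_andrasfai_mod_iff[OF k, folded m_def]
  have sym: "(y, x) \<in> parcs (andrasfai k)" if "(x, y) \<in> parcs (andrasfai k)" for x y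
    using pair_graphD(3)[OF pair_graph_andrasfai[OF k]] that by (auto simp: sym_def)
  have left: "\<exists>w. (u, w) \<in> parcs (andrasfai k) \<and> (w, t) \<in> parcs (andrasfai k)"
    if ut: "u \<in> {0..<m}" "t \<in> {0..<m}" "u \<noteq> t"
      and t': "u \<le> t'" "t' < u + m" "t' mod m = t" "(t' - u) mod 3 = 0" for u t t'
  proof -
    have "t' \<noteq> u + (m - 1)"
    proof
      assume "t' = u + (m - 1)"
      then have "(m - 1) mod 3 = 0" using t'(4) by simp
      then show False unfolding m_def by presburger
    qed
    then have le: "t' < u - 1 + m" using t' by linarith
    have "m \<ge> 2" using k by (simp add: m_def)
    then have "((u - 1) mod m, u mod m) \<in> parcs (andrasfai k)" by (subst iff) auto
    moreover have "((u - 1) mod m, t' mod m) \<in> parcs (andrasfai k)"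
    proof (subst iff)
      show "(t' - (u - 1)) mod 3 = 1" using t'(4) by presburger
    qed (use t' le in auto)
    ultimately show ?thesis using ut t' sym by (intro exI[of _ "(u - 1) mod m"]) auto
  qed
  fix u t assume "u \<in> pverts (andrasfai k)" "t \<in> pverts (andrasfai k)" "u \<noteq> t" "(u, t) \<notin> parcs (andrasfai k)"
  then have ut: "u \<in> {0..<m}" "t \<in> {0..<m}" "u \<noteq> t" and na: "(u, t) \<notin> parcs (andrasfai k)"
    by (auto simp: andrasfai_sel[OF k] m_def)
  define s where "s = (if u \<le> t then t else t + m)"
  have s: "u \<le> s" "s < u + m" "s mod m = t" using ut by (auto simp: s_def)
  have "(s - u) mod 3 \<noteq> 1" using iff[OF s(1,2)] s(3) na ut by simp
  then have "(s - u) mod 3 = 0 \<or> (s - u) mod 3 = 2" by presburger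
  then consider "(s - u) mod 3 = 0" | "(s - u) mod 3 = 2" by blast
  then show "\<exists>w. (u, w) \<in> parcs (andrasfai k) \<and> (w, t) \<in> parcs (andrasfai k)"
  proof cases
    case 1
    then show ?thesis by (rule left[OF ut s])
  next
    case 2
    define r where "r = (if t \<le> u then u else u + m)"
    have "(r - t) mod 3 = 0"
    proof -
      have "r - t = m - (s - u)" using ut by (auto simp: r_def s_def)
      then show ?thesis using 2 unfolding m_def by presburger
    qed
    moreover have "t \<le> r" "r < t + m" "r mod m = u" using ut by (auto simp: r_def)
    ultimately have "\<exists>w. (t, w) \<in> parcs (andrasfai k) \<and> (w, u) \<in> parcs (andrasfai k)"
      using left[OF ut(2,1)] ut(3) by metis
    then show ?thesis using sym by blast
  qed
qed

text \<open>
  Vertices that are not adjacent in the complement have a difference \<open>1, 4, 7, \<dots>\<close>. A common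
  neighbour of \<open>u\<close> and \<open>u + 1\<close> is \<open>u + 3\<close>; for larger differences \<open>u + 2\<close> is one.
\<close>

lemma diameter_complement_andrasfai:
  assumes k: "k \<ge> 2" shows "diameter_le_2 (complement_graph (andrasfai k))"
  unfolding diameter_le_2_def
proof (intro ballI impI)
  define m where "m = 3 * int k - 1"
  have m: "m \<ge> 5" using k by (simp add: m_def)
  let ?H = "complement_graph (andrasfai k)"
  have k1: "k \<ge> 1" using k by simp
  note iff = parcs_andrasfai_mod_iff[OF k1, folded m_def]
  have symA: "(y, x) \<in> parcs (andrasfai k)" if "(x, y) \<in> parcs (andrasfai k)" for x y
    using pair_graphD(3)[OF pair_graph_andrasfai[OF k1]] that by (auto simp: sym_def)
  have sym: "(y, x) \<in> parcs ?H" if "(x, y) \<in> parcs ?H" for x y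
    using that symA by (auto simp: complement_graph_def)
  have adj: "(x mod m, t mod m) \<in> parcs ?H" if "x < t" "t < x + m" "(t - x) mod 3 \<noteq> 1" for x t
  proof -
    have "x mod m \<noteq> t mod m"
    proof
      assume "x mod m = t mod m"
      then have "m dvd t - x" by (metis mod_eq_dvd_iff)
      then show False using that zdvd_imp_le[of m "t - x"] by simp
    qed
    then show ?thesis using iff[of x t] that m
      by (auto simp: complement_graph_def andrasfai_sel[OF k1] simp flip: m_def)
  qed
  fix u t assume "u \<in> pverts ?H" "t \<in> pverts ?H" "u \<noteq> t" "(u, t) \<notin> parcs ?H"
  then have ut: "u \<in> {0..<m}" "t \<in> {0..<m}" and ad: "(u, t) \<in> parcs (andrasfai k)"
    by (auto simp: andrasfai_sel(1)[OF k1] complement_graph_def m_def)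
  define s where "s = (if u \<le> t then t else t + m)"
  have s: "u \<le> s" "s < u + m" "s mod m = t" using ut by (auto simp: s_def)
  have s3: "(s - u) mod 3 = 1" using iff[OF s(1,2)] s(3) ad ut by simp
  have um: "u mod m = u" using ut by simp
  show "\<exists>w. (u, w) \<in> parcs ?H \<and> (w, t) \<in> parcs ?H"
  proof (cases "s = u + 1")
    case True
    have "(u mod m, (u + 3) mod m) \<in> parcs ?H" by (rule adj) (use m in auto)
    moreover have "(s mod m, (u + 3) mod m) \<in> parcs ?H" by (rule adj) (use m True in auto)
    ultimately show ?thesis using sym s um by metis
  next
    case False
    then have "u + 2 < s" using s3 s by presburger
    moreover have "(s - (u + 2)) mod 3 \<noteq> 1" using s3 by presburger
    ultimately have "((u + 2) mod m, s mod m) \<in> parcs ?H" using s by (intro adj) auto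
    moreover have "(u mod m, (u + 2) mod m) \<in> parcs ?H" by (rule adj) (use m in auto)
    ultimately show ?thesis using s um by metis
  qed
qed

section \<open>The lower bound\<close>

text \<open>
  Take the representative \<open>s\<close> of a separating vertex in the period beginning at \<open>x\<close>. Beyond
  \<open>x + 3 d\<close> its differences to \<open>x\<close> and to \<open>x + 3 d\<close> agree modulo 3, and at \<open>x + 3 e\<close> with
  \<open>0 < e < d\<close> both are divisible by 3; in neither case does \<open>s\<close> separate the two.
\<close>

lemma card_ge_of_separating:
  fixes W :: "int set" and k :: nat
  assumes k: "k \<ge> 2" and W: "W \<subseteq> pverts (andrasfai k)"
    and sep: "\<And>u v. u \<in> pverts (andrasfai k) \<Longrightarrow> v \<in> pverts (andrasfai k) \<Longrightarrow> u \<noteq> v \<Longrightarrow>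
      \<exists>t \<in> W. t = u \<or> t = v \<or> ((u, t) \<in> parcs (andrasfai k)) \<noteq> ((v, t) \<in> parcs (andrasfai k))"
  shows "k \<le> card W"
proof (rule card_ge_of_windows[OF k])
  define m where "m = 3 * int k - 1"
  have m: "m > 0" using k by (simp add: m_def)
  have k1: "k \<ge> 1" using k by simp
  note iff = parcs_andrasfai_mod_iff[OF k1, folded m_def]
  have V: "pverts (andrasfai k) = {0..<m}" by (simp add: andrasfai_sel(1)[OF k1] m_def)
  show "finite W" using W V finite_subset by auto
  fix x d :: int assume d: "1 \<le> d" "d \<le> int k - 1"
  have dm: "3 * d < m" using d by (simp add: m_def)
  have "x mod m \<noteq> (x + 3 * d) mod m"
  proof
    assume "x mod m = (x + 3 * d) mod m"
    then have "m dvd (x + 3 * d) - x" by (metis mod_eq_dvd_iff)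
    then show False using dm d zdvd_imp_le[of m "3 * d"] by simp
  qed
  then obtain t where t: "t \<in> W" "t = x mod m \<or> t = (x + 3 * d) mod m \<or>
      ((x mod m, t) \<in> parcs (andrasfai k)) \<noteq> (((x + 3 * d) mod m, t) \<in> parcs (andrasfai k))"
    using sep[of "x mod m" "(x + 3 * d) mod m"] m V by auto
  define s where "s = x + (t - x) mod m"
  have tm: "t mod m = t" using t W V by auto
  have s: "x \<le> s" "s < x + m" "s mod m = t"
    using m tm by (simp_all add: s_def mod_simps)
  have sep': "s \<le> x + 3 * d \<and> (\<forall>e. 0 < e \<and> e < d \<longrightarrow> s \<noteq> x + 3 * e)"
  proof (rule ccontr)
    assume neg: "\<not> ?thesis"
    have neq: "s mod m \<noteq> y mod m" if "\<bar>s - y\<bar> < m" "s \<noteq> y" for y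
    proof
      assume "s mod m = y mod m"
      then have "m dvd \<bar>s - y\<bar>" by (simp add: mod_eq_dvd_iff)
      then show False using that zdvd_imp_le[of m "\<bar>s - y\<bar>"] by simp
    qed
    have "t \<noteq> x mod m" "t \<noteq> (x + 3 * d) mod m"
      using neq[of x] neq[of "x + 3 * d"] s neg d dm by auto
    then have ne: "((x mod m, s mod m) \<in> parcs (andrasfai k)) \<noteq> (((x + 3 * d) mod m, s mod m) \<in> parcs (andrasfai k))"
      using t(2) s(3) by auto
    show False
    proof (cases "s \<le> x + 3 * d")
      case True
      then obtain e where e: "0 < e" "e < d" "s = x + 3 * e" using neg by blast
      have "((x + 3 * d) mod m, s mod m) \<in> parcs (andrasfai k) \<longleftrightarrow> (s mod m, (x + 3 * d) mod m) \<in> parcs (andrasfai k)"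
        using pair_graphD(3)[OF pair_graph_andrasfai[OF k1]] by (auto simp: sym_def)
      also have "\<dots> \<longleftrightarrow> (x + 3 * d - s) mod 3 = 1" using e dm by (intro iff) auto
      also have "\<dots> \<longleftrightarrow> False" using e by presburger
      finally show False using ne iff[OF s(1,2)] e by simp
    next
      case False
      then have "((x + 3 * d) mod m, s mod m) \<in> parcs (andrasfai k) \<longleftrightarrow> (s - (x + 3 * d)) mod 3 = 1"
        using s d by (intro iff) auto
      also have "\<dots> \<longleftrightarrow> (s - x) mod 3 = 1" by presburger
      finally show False using ne iff[OF s(1,2)] by simp
    qed
  qed
  then show "meets_window {x. x mod (3 * int k - 1) \<in> W} x d"
    unfolding meets_window_def using s t(1) by (intro bexI[of _ s]) (auto simp: m_def)
qed

text \<open>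
  The hypothesis \<open>same_separation\<close> is what \<open>And(k)\<close> and its complement have in common: a third vertex that
  does not separate two vertices by adjacency in \<open>And(k)\<close> does not do so in \<open>G\<close>.
\<close>

lemma card_resolving_set_product_ge:
  assumes k: "k \<ge> 2" and n: "n \<ge> 1"
    and G: "pair_graph G" "diameter_le_2 G" "pverts G = pverts (andrasfai k)"
    and same_separation: "\<And>u v t. u \<in> pverts G \<Longrightarrow> v \<in> pverts G \<Longrightarrow> t \<in> pverts G \<Longrightarrow> t \<noteq> u \<Longrightarrow> t \<noteq> v \<Longrightarrow>
      ((u, t) \<in> parcs (andrasfai k) \<longleftrightarrow> (v, t) \<in> parcs (andrasfai k)) \<Longrightarrow>
      ((u, t) \<in> parcs G \<longleftrightarrow> (v, t) \<in> parcs G)"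
    and W: "resolving_set (G \<box> path_graph n) W"
  shows "k \<le> card W"
proof -
  have sub: "W \<subseteq> pverts G \<times> {..<n}"
    using W by (auto simp: resolving_set_def cartesian_product_def path_graph_def)
  have fin: "finite W" using sub pair_graphD(1)[OF G(1)] finite_subset by blast
  have "k \<le> card (fst ` W)"
  proof (rule card_ge_of_separating[OF k])
    show "fst ` W \<subseteq> pverts (andrasfai k)" using sub G(3) by auto
    fix u v assume uv: "u \<in> pverts (andrasfai k)" "v \<in> pverts (andrasfai k)" "u \<noteq> v"
    then obtain t where t: "t \<in> fst ` W" "dist2 G u t \<noteq> dist2 G v t"
      using resolving_set_projection[OF G(1,2) n W] G(3) by metis
    have "t \<in> pverts G" using t(1) sub by auto
    then have "t = u \<or> t = v \<or> ((u, t) \<in> parcs (andrasfai k)) \<noteq> ((v, t) \<in> parcs (andrasfai k))"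
      using same_separation[of u v t] uv G(3) t(2) by (auto simp: dist2_def split: if_splits)
    then show "\<exists>t\<in>fst ` W. t = u \<or> t = v \<or> ((u, t) \<in> parcs (andrasfai k)) \<noteq> ((v, t) \<in> parcs (andrasfai k))"
      using t(1) by blast
  qed
  also have "\<dots> \<le> card W" using fin by (rule card_image_le)
  finally show ?thesis .
qed

section \<open>Resolving sets of size \<open>k\<close>\<close>

lemma dist2_andrasfai:
  assumes "k \<ge> 1" "u \<in> pverts (andrasfai k)" "t \<in> pverts (andrasfai k)"
  shows "dist2 (andrasfai k) u t =
    (if u = t then 0 else if (if t \<le> u then (u - t) mod 3 = 1 else (t - u) mod 3 = 1) then 1 else 2)"
  using assms parcs_andrasfai_iff[OF assms(1), of u t] by (simp add: dist2_def andrasfai_sel(1))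

lemma dist2_complement_andrasfai:
  assumes "k \<ge> 1" "u \<in> pverts (andrasfai k)" "t \<in> pverts (andrasfai k)"
  shows "dist2 (complement_graph (andrasfai k)) u t =
    (if u = t then 0 else if (if t \<le> u then (u - t) mod 3 = 1 else (t - u) mod 3 = 1) then 2 else 1)"
  using assms parcs_andrasfai_iff[OF assms(1), of u t]
  by (simp add: dist2_def complement_graph_def andrasfai_sel(1))

lemma andrasfai_vertex_div_3:
  assumes k: "k \<ge> 1" and x: "x \<in> pverts (andrasfai k)"
  shows "\<exists>q \<ge> 0. q < int k \<and> (x = 3 * q \<or> x = 3 * q + 1 \<or> x = 3 * q + 2 \<and> q < int k - 1)"
  using x by (intro exI[of _ "x div 3"]) (simp add: andrasfai_sel(1)[OF k]; presburger)

text \<open>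
  The vertices \<open>0, 3, \<dots>, 3 (k - 1)\<close> are pairwise at distance 2. Listing distances to them in this
  order, \<open>3 q\<close> has code \<open>2 \<dots> 2 0 2 \<dots> 2\<close>, while \<open>3 q + 1\<close> has \<open>q + 1\<close> ones followed by twos and
  \<open>3 q + 2\<close> has \<open>q + 1\<close> twos followed by at least one 1. These codes are distinct, and no two of
  them differ by a constant, the code \<open>2 \<dots> 2\<close> being absent.
\<close>

lemma andrasfai_doubly_resolved:
  fixes k :: nat and u v :: int and i j :: nat
  assumes k: "k \<ge> 2" and u: "u \<in> pverts (andrasfai k)" and v: "v \<in> pverts (andrasfai k)"
    and eq: "\<And>t. t \<in> (\<lambda>p. 3 * p) ` {0..<int k} \<Longrightarrow>
      dist2 (andrasfai k) u t + i = dist2 (andrasfai k) v t + j"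
  shows "u = v \<and> i = j"
proof -
  have k1: "k \<ge> 1" using k by simp
  define D :: "int \<Rightarrow> int \<Rightarrow> int" where "D x p =
    (if x = 3 * p then 0 else if (if 3 * p \<le> x then (x - 3 * p) mod 3 = 1 else (3 * p - x) mod 3 = 1) then 1 else 2)" for x p
  have E: "D u p + int i = D v p + int j" if "0 \<le> p" "p < int k" for p
  proof -
    have "3 * p \<in> pverts (andrasfai k)" using that by (simp add: andrasfai_sel(1)[OF k1])
    then have "int (dist2 (andrasfai k) x (3 * p)) = D x p" if "x \<in> pverts (andrasfai k)" for x
      using that by (simp add: dist2_andrasfai[OF k1] D_def)
    moreover have "dist2 (andrasfai k) u (3 * p) + i = dist2 (andrasfai k) v (3 * p) + j"
      using that by (intro eq) simp
    ultimately show ?thesis using u v by (metis of_nat_add)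
  qed
  have D0: "D (3 * q) p = (if p = q then 0 else 2)" for p q unfolding D_def by (simp; presburger)
  have D1: "D (3 * q + 1) p = (if p \<le> q then 1 else 2)" for p q unfolding D_def by (simp; presburger)
  have D2: "D (3 * q + 2) p = (if p \<le> q then 2 else 1)" for p q unfolding D_def by (simp; presburger)
  obtain q where q: "0 \<le> q" "q < int k" "u = 3 * q \<or> u = 3 * q + 1 \<or> u = 3 * q + 2 \<and> q < int k - 1"
    using andrasfai_vertex_div_3[OF k1 u] by blast
  obtain r where r: "0 \<le> r" "r < int k" "v = 3 * r \<or> v = 3 * r + 1 \<or> v = 3 * r + 2 \<and> r < int k - 1"
    using andrasfai_vertex_div_3[OF k1 v] by blast
  \<comment> \<open>The codes at the first and last positions and at the positions where one of the two codes
    may change are enough to tell them apart.\<close>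
  have "u = v"
    using q(3) r(3) E[of 0] E[of "int k - 1"] E[OF q(1,2)] E[OF r(1,2)] E[of "q + 1"] E[of "r + 1"] q(1,2) r(1,2) k
    by (elim disjE conjE) (auto simp: D0 D1 D2 split: if_splits)
  then show ?thesis using E[of 0] k by simp
qed

text \<open>
  In the complement the set \<open>{0, 3, \<dots>, 3 (k - 1)}\<close> fails: the code \<open>0 1 \<dots> 1\<close> of the vertex 0 and
  the code \<open>1 2 \<dots> 2\<close> differ by a constant. The set \<open>1, 4, \<dots>, 3 (k - 2) + 1\<close> of \<open>k - 1\<close> vertices
  gives the codes \<open>1 \<dots> 1 2 \<dots> 2\<close> to \<open>3 q\<close>, \<open>1 \<dots> 1 0 1 \<dots> 1\<close> to \<open>3 q + 1\<close>
  (without the 0 if \<open>q = k - 1\<close>) and \<open>2 \<dots> 2 1 \<dots> 1\<close> to \<open>3 q + 2\<close>. The distance to the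
  additional vertex 0, which is 0, 1 or 2, removes the remaining coincidences, namely the codes
  \<open>2 \<dots> 2\<close> and \<open>1 \<dots> 1\<close>, and the pairs that differ by a constant.
\<close>

lemma complement_andrasfai_doubly_resolved:
  fixes k :: nat and u v :: int and i j :: nat
  assumes k: "k \<ge> 2" and u: "u \<in> pverts (andrasfai k)" and v: "v \<in> pverts (andrasfai k)"
    and eq: "\<And>t. t \<in> insert 0 ((\<lambda>p. 3 * p + 1) ` {0..<int k - 1}) \<Longrightarrow>
      dist2 (complement_graph (andrasfai k)) u t + i = dist2 (complement_graph (andrasfai k)) v t + j"
  shows "u = v \<and> i = j"
proof -
  have k1: "k \<ge> 1" using k by simp
  define C :: "int \<Rightarrow> int \<Rightarrow> int" where "C x t =
    (if x = t then 0 else if (if t \<le> x then (x - t) mod 3 = 1 else (t - x) mod 3 = 1) then 2 else 1)" for x t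
  have E: "C u t + int i = C v t + int j"
    if "t \<in> insert 0 ((\<lambda>p. 3 * p + 1) ` {0..<int k - 1})" for t
  proof -
    have "t \<in> pverts (andrasfai k)" using that k by (auto simp: andrasfai_sel(1)[OF k1])
    then have "int (dist2 (complement_graph (andrasfai k)) x t) = C x t" if "x \<in> pverts (andrasfai k)" for x
      using that by (simp add: dist2_complement_andrasfai[OF k1] C_def)
    then show ?thesis using eq[OF that] u v by (metis of_nat_add)
  qed
  define D where "D x p = C x (3 * p + 1)" for x p
  have ED: "D u p + int i = D v p + int j" if "0 \<le> p" "p < int k - 1" for p
    using E[of "3 * p + 1"] that by (simp add: D_def)
  have EC: "C u 0 + int i = C v 0 + int j" by (rule E) simp
  have D0: "D (3 * q) p = (if q \<le> p then 2 else 1)" for p q unfolding D_def C_def by (simp; presburger)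
  have D1: "D (3 * q + 1) p = (if p = q then 0 else 1)" for p q unfolding D_def C_def by (simp; presburger)
  have D2: "D (3 * q + 2) p = (if p \<le> q then 2 else 1)" for p q unfolding D_def C_def by (simp; presburger)
  have C0: "C (3 * q) 0 = (if q = 0 then 0 else 1)" if "0 \<le> q" for q using that unfolding C_def by (simp; presburger)
  have C1: "C (3 * q + 1) 0 = 2" if "0 \<le> q" for q using that unfolding C_def by (simp; presburger)
  have C2: "C (3 * q + 2) 0 = 1" if "0 \<le> q" for q using that unfolding C_def by (simp; presburger)
  obtain q where q: "0 \<le> q" "q < int k" "u = 3 * q \<or> u = 3 * q + 1 \<or> u = 3 * q + 2 \<and> q < int k - 1"
    using andrasfai_vertex_div_3[OF k1 u] by blast
  obtain r where r: "0 \<le> r" "r < int k" "v = 3 * r \<or> v = 3 * r + 1 \<or> v = 3 * r + 2 \<and> r < int k - 1"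
    using andrasfai_vertex_div_3[OF k1 v] by blast
  \<comment> \<open>Besides the distance to 0, the first and last positions and the positions \<open>q\<close> and \<open>r\<close> are
    enough to tell the codes apart.\<close>
  have "u = v"
  proof (cases "u = 3 * q + 1 \<and> v = 3 * r + 1")
    case True
    then have "i = j" using EC C1 q(1) r(1) by simp
    show ?thesis
    proof (rule ccontr)
      assume "u \<noteq> v"
      then have "q \<noteq> r" using True by simp
      moreover from this have "0 \<le> min q r" "min q r < int k - 1" using q r by auto
      ultimately show False using ED[of "min q r"] \<open>i = j\<close> True by (simp add: D1 min_def split: if_splits)
    qed
  next
    case False
    then show ?thesis
      using q(3) r(3) EC ED[of 0] ED[of "int k - 2"] ED[OF q(1)] ED[OF r(1)] q(1,2) r(1,2) k
      by (elim disjE conjE) (auto simp: C0 C1 C2 D0 D1 D2 split: if_splits)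
  qed
  then show ?thesis using EC by simp
qed

section \<open>The metric dimensions\<close>

lemma metric_dim_andrasfai_path:
  assumes k: "k \<ge> 2" and n: "n \<ge> 1"
  shows "metric_dim (andrasfai k \<box> path_graph n) = k"
proof -
  have k1: "k \<ge> 1" using k by simp
  have G: "pair_graph (andrasfai k)" "diameter_le_2 (andrasfai k)"
    using pair_graph_andrasfai diameter_andrasfai k1 by auto
  let ?W = "(\<lambda>p. 3 * p) ` {0..<int k}"
  show ?thesis
  proof (rule metric_dim_eqI)
    show "pair_graph (andrasfai k \<box> path_graph n)"
      by (rule pair_graph_cartesian_product[OF G(1) pair_graph_path_graph])
    show "resolving_set (andrasfai k \<box> path_graph n) (?W \<times> {0})"
      by (rule resolving_set_bottom_layer[OF G n _ andrasfai_doubly_resolved[OF k]])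
        (auto simp: andrasfai_sel(1)[OF k1])
    show "card (?W \<times> {0}) = k" by (simp add: card_cartesian_product card_image inj_on_def)
    show "k \<le> card W" if "resolving_set (andrasfai k \<box> path_graph n) W" for W
      by (rule card_resolving_set_product_ge[OF k n G _ _ that]) auto
  qed
qed

lemma metric_dim_complement_andrasfai_path:
  assumes k: "k \<ge> 2" and n: "n \<ge> 1"
  shows "metric_dim (complement_graph (andrasfai k) \<box> path_graph n) = k"
proof -
  let ?H = "complement_graph (andrasfai k)"
  have k1: "k \<ge> 1" using k by simp
  have V: "pverts ?H = pverts (andrasfai k)" by (simp add: complement_graph_def)
  have G: "pair_graph ?H" "diameter_le_2 ?H"
    using pair_graph_complement_graph[OF pair_graph_andrasfai[OF k1]] diameter_complement_andrasfai[OF k] by auto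
  let ?W = "insert 0 ((\<lambda>p. 3 * p + 1) ` {0..<int k - 1})"
  show ?thesis
  proof (rule metric_dim_eqI)
    show "pair_graph (?H \<box> path_graph n)"
      by (rule pair_graph_cartesian_product[OF G(1) pair_graph_path_graph])
    show "resolving_set (?H \<box> path_graph n) (?W \<times> {0})"
      by (rule resolving_set_bottom_layer[OF G n _ complement_andrasfai_doubly_resolved[OF k]])
        (use k in \<open>auto simp: V andrasfai_sel(1)[OF k1]\<close>)
    have "(0 :: int) \<notin> (\<lambda>p. 3 * p + 1) ` {0..<int k - 1}" by (auto; presburger)
    then show "card (?W \<times> {0}) = k"
      using k by (simp add: card_cartesian_product card_image inj_on_def)
    show "k \<le> card W" if "resolving_set (?H \<box> path_graph n) W" for W
      by (rule card_resolving_set_product_ge[OF k n G V _ that]) (auto simp: complement_graph_def)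
  qed
qed

theorem theorem2p3:
  fixes k n :: nat
  assumes "k \<ge> 2" and "n \<ge> 2"
  shows "metric_dim (andrasfai k \<box> path_graph n) = k
    \<and> metric_dim (complement_graph (andrasfai k) \<box> path_graph n) = k
    \<and> metric_dim (prism (andrasfai k)) = k
    \<and> metric_dim (prism (complement_graph (andrasfai k))) = k"
  unfolding prism_def
  using assms metric_dim_andrasfai_path metric_dim_complement_andrasfai_path by simp

end
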